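(* Let $\{i,j\}=\{1,2\}$ and let $(S,S_1,S_2)$ be a dense and complemented subbilocale of a bilocale $(L,L_1,L_2)$ whose $j$-$G_\delta$-sublocales are complemented. The following statements are equivalent: (1) $(S,S_1,S_2)$ is relatively $(i,j)$-Baire. (2) For every non-void $i$-open sublocale $U$ of $L$, $S\cap U$ is of $(j,i)$-second category in $(S,S_1,S_2)$. (3) For every sublocale $U$ of $(j,i)$-first category in $(L,L_1,L_2)$, $\mathrm{int}_{i_S}(S\cap U)=\mathsf O$. (4) If $V$ is a sublocale of $(j,i)$-first category in $(L,L_1,L_2)$, then $S\cap(L\smallsetminus V)$ is $i_S$-dense.
   Context: A locale is a complete lattice $L$ with $a\wedge\bigvee B=\bigvee\{a\wedge b:b\in B\}$ for all $a\in L$, $B\subseteq L$; $\to$ is its Heyting operation. A subframe of $L$ is a subset closed under all joins and finite meets. A bilocale is a triple $(L,L_1,L_2)$ with $L_1,L_2$ subframes of a locale $L$ such that $a=\bigvee\{a_1\wedge a_2:a_1\in L_1,a_2\in L_2,a_1\wedge a_2\le a\}$ for all $a\in L$. A sublocale of $L$ is a subset $S$ closed under all meets with $x\to s\in S$ for all $x\in L$, $s\in S$; it is itself a locale in the induced order. Sublocales of $L$ ordered by inclusion form a coframe $\mathcal S(L)$ in which meets are intersections; joins of sublocales are taken in $\mathcal S(L)$. The void sublocale is $\mathsf O=\{1\}$. A sublocale is complemented if it has a complement in $\mathcal S(L)$; $L\smallsetminus V=\bigvee\{T\in\mathcal S(L):T\cap V=\mathsf O\}$. For $a\in L$, $\mathfrak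 o(a)=\{a\to x:x\in L\}$ is an open sublocale and $\mathfrak c(a)=\{x\in L:a\le x\}$ a closed sublocale. A sublocale is dense if the smallest closed sublocale containing it is $L$. With $\nu_S(a)=\bigwedge\{s\in S:a\le s\}$, a subbilocale of $(L,L_1,L_2)$ is a triple $(S,S_1,S_2)$ with $S$ a sublocale of $L$ and $S_k=\nu_S[L_k]$ ($k=1,2$); it is a bilocale, and it is dense (complemented) if $S$ is dense (complemented) in $L$. For a bilocale $(L,L_1,L_2)$ and $k\in\{1,2\}$: a sublocale is $k$-open if it equals $\mathfrak o(a)$ for some $a\in L_k$; a $k$-$G_\delta$-sublocale is one of the form $\bigwedge_{n\in\mathbb N}\mathfrak o(x_n)$ with all $x_n\in L_k$; $\mathrm{cl}_k(A)=\bigcap\{\mathfrak c(a):a\in L_k,\ A\subseteq\mathfrak c(a)\}$; $\mathrm{int}_k(A)=\bigvee\{\mathfrak o(a):a\in L_k,\ \mathfrak o(a)\subseteq A\}$; $A$ is $k$-dense if $\mathrm{cl}_k(A)=L$. A sublocale $A$ is $(j,i)$-nowhere dense if $\mathrm{int}_i(\mathrm{cl}_j(A))=\mathsf O$; it is of $(j,i)$-first category if $A\subseteq\bigvee_{n\in\mathbb N}A_n$ for some $(j,i)$-nowhere dense sublocales $A_n$, and of $(j,i)$-second category otherwise. The notions $i_S$-dense, $\mathrm{int}_{i_S}$, and category "in $(S,S_1,S_2)$" are the corresponding notions in the bilocale $(S,S_1,S_2)$. The subbilocale $(S,S_1,S_2)$ is relatively $(i,j)$-Baire if for every collection $\{\mathfrak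 o(x_n):n\in\mathbb N\}$ of $i$-dense $j$-open sublocales of $L$, $S\cap\bigwedge_{n\in\mathbb N}\mathfrak o(x_n)$ is $i_S$-dense. *)

theory Defs
  imports Main
begin

class frame = complete_lattice +
  assumes inf_Sup_distrib: "inf a (Sup B) = Sup {inf a b | b. b \<in> B}"

text \<open>
  A sublocale is itself a locale in the induced order, and the same notions are needed in a locale
  and in its sublocales.  Every notion below is therefore relative to a carrier \<open>C\<close>, which
  is either the whole frame type (\<open>UNIV\<close>) or a sublocale of it.  Such a carrier is closed
  under meets, so its meets (and its top) are those of the type; its joins and its Heyting
  operation are defined from the order induced on \<open>C\<close>.
\<close>

definition join_in :: "'a::frame set \<Rightarrow> 'a set \<Rightarrow> 'a" where
  "join_in C B = Inf {c \<in> C. \<forall>b\<in>B. b \<le> c}"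

definition imp_in :: "'a::frame set \<Rightarrow> 'a \<Rightarrow> 'a \<Rightarrow> 'a" where
  "imp_in C x y = join_in C {z \<in> C. inf z x \<le> y}"

definition subframe :: "'a::frame set \<Rightarrow> 'a set \<Rightarrow> bool" where
  "subframe C F \<longleftrightarrow> F \<subseteq> C \<and> (\<forall>B\<subseteq>F. join_in C B \<in> F) \<and> (\<forall>B\<subseteq>F. finite B \<longrightarrow> Inf B \<in> F)"

subsection \<open>The coframe of sublocales\<close>

definition sublocales :: "'a::frame set \<Rightarrow> 'a set set" where
  "sublocales C = {S. S \<subseteq> C \<and> (\<forall>B\<subseteq>S. Inf B \<in> S) \<and> (\<forall>x\<in>C. \<forall>s\<in>S. imp_in C x s \<in> S)}"

definition void :: "'a::frame set" where
  "void = {top}"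

text \<open>Meets of sublocales are intersections, so the join is the intersection of all upper bounds.\<close>

definition sl_join :: "'a::frame set \<Rightarrow> 'a set set \<Rightarrow> 'a set" where
  "sl_join C \<T> = \<Inter>{S \<in> sublocales C. \<forall>T\<in>\<T>. T \<subseteq> S}"

definition complemented :: "'a::frame set \<Rightarrow> 'a set \<Rightarrow> bool" where
  "complemented C S \<longleftrightarrow> S \<in> sublocales C \<and> (\<exists>T\<in>sublocales C. S \<inter> T = void \<and> sl_join C {S, T} = C)"

definition sl_diff :: "'a::frame set \<Rightarrow> 'a set \<Rightarrow> 'a set" where
  "sl_diff C V = sl_join C {T \<in> sublocales C. T \<inter> V = void}"

definition open_sl :: "'a::frame set \<Rightarrow> 'a \<Rightarrow> 'a set" where
  "open_sl C a = {imp_in C a x | x. x \<in> C}"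

definition closed_sl :: "'a::frame set \<Rightarrow> 'a \<Rightarrow> 'a set" where
  "closed_sl C a = {x \<in> C. a \<le> x}"

definition dense_sl :: "'a::frame set \<Rightarrow> 'a set \<Rightarrow> bool" where
  "dense_sl C S \<longleftrightarrow> \<Inter>{closed_sl C a | a. a \<in> C \<and> S \<subseteq> closed_sl C a} = C"

definition nucleus :: "'a::frame set \<Rightarrow> 'a \<Rightarrow> 'a" where
  "nucleus S a = Inf {s \<in> S. a \<le> s}"

text \<open>
  Consistency of the carrier-relative operations: on the whole frame they are the usual join and
  Heyting operation, and a sublocale inherits the Heyting operation of the frame.
\<close>

lemma join_in_UNIV: "join_in UNIV B = Sup B"
  unfolding join_in_def by (intro antisym Inf_lower Inf_greatest) (auto intro: Sup_upper Sup_least)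

lemma le_imp_in_UNIV: "z \<le> imp_in UNIV x y \<longleftrightarrow> inf z x \<le> y"
proof
  assume "z \<le> imp_in UNIV x y"
  then have "inf x z \<le> inf x (Sup {w. inf w x \<le> y})"
    by (simp add: imp_in_def join_in_UNIV le_infI2)
  also have "\<dots> \<le> y"
    unfolding inf_Sup_distrib by (rule Sup_least) (auto simp: inf_commute)
  finally show "inf z x \<le> y" by (simp add: inf_commute)
next
  assume "inf z x \<le> y"
  then show "z \<le> imp_in UNIV x y"
    by (simp add: imp_in_def join_in_UNIV Sup_upper)
qed

lemma imp_in_sublocale:
  assumes "C \<in> sublocales UNIV" "x \<in> C" "y \<in> C"
  shows "imp_in C x y = imp_in UNIV x y"
proof (rule antisym)
  have m: "imp_in UNIV x y \<in> C"
    using assms by (auto simp: sublocales_def)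
  show "imp_in C x y \<le> imp_in UNIV x y"
    unfolding imp_in_def [of C] join_in_def [of C]
    by (rule Inf_lower) (use m in \<open>auto simp: le_imp_in_UNIV\<close>)
  have "inf (imp_in UNIV x y) x \<le> y"
    by (simp flip: le_imp_in_UNIV)
  then show "imp_in UNIV x y \<le> imp_in C x y"
    unfolding imp_in_def [of C] join_in_def [of C]
    by (intro Inf_greatest) (use m in auto)
qed

subsection \<open>Bilocales\<close>

type_synonym 'a triple = "'a set \<times> 'a set \<times> 'a set"

definition carr :: "'a triple \<Rightarrow> 'a set" where
  "carr X = fst X"

text \<open>The parts are only used with index 1 or 2.\<close>

definition part :: "nat \<Rightarrow> 'a triple \<Rightarrow> 'a set" where
  "part k X = (if k = 1 then fst (snd X) else snd (snd X))"

definition bilocale :: "'a::frame triple \<Rightarrow> bool" where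
  "bilocale X \<longleftrightarrow>
     carr X \<in> sublocales UNIV \<and> subframe (carr X) (part 1 X) \<and> subframe (carr X) (part 2 X) \<and>
     (\<forall>a\<in>carr X.
        a = join_in (carr X) {inf a1 a2 | a1 a2. a1 \<in> part 1 X \<and> a2 \<in> part 2 X \<and> inf a1 a2 \<le> a})"

definition subbilocale :: "'a::frame triple \<Rightarrow> 'a triple \<Rightarrow> bool" where
  "subbilocale Y X \<longleftrightarrow>
     carr Y \<in> sublocales (carr X) \<and>
     part 1 Y = nucleus (carr Y) ` part 1 X \<and> part 2 Y = nucleus (carr Y) ` part 2 X"

definition is_open :: "nat \<Rightarrow> 'a::frame triple \<Rightarrow> 'a set \<Rightarrow> bool" where
  "is_open k X U \<longleftrightarrow> (\<exists>a\<in>part k X. U = open_sl (carr X) a)"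

definition is_Gdelta :: "nat \<Rightarrow> 'a::frame triple \<Rightarrow> 'a set \<Rightarrow> bool" where
  "is_Gdelta k X G \<longleftrightarrow>
     (\<exists>x::nat \<Rightarrow> 'a. (\<forall>n. x n \<in> part k X) \<and> G = (\<Inter>n. open_sl (carr X) (x n)))"

definition cl :: "nat \<Rightarrow> 'a::frame triple \<Rightarrow> 'a set \<Rightarrow> 'a set" where
  "cl k X A = \<Inter>{closed_sl (carr X) a | a. a \<in> part k X \<and> A \<subseteq> closed_sl (carr X) a}"

definition intr :: "nat \<Rightarrow> 'a::frame triple \<Rightarrow> 'a set \<Rightarrow> 'a set" where
  "intr k X A = sl_join (carr X) {open_sl (carr X) a | a. a \<in> part k X \<and> open_sl (carr X) a \<subseteq> A}"

definition is_dense :: "nat \<Rightarrow> 'a::frame triple \<Rightarrow> 'a set \<Rightarrow> bool" where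
  "is_dense k X A \<longleftrightarrow> cl k X A = carr X"

definition nowhere_dense :: "nat \<Rightarrow> nat \<Rightarrow> 'a::frame triple \<Rightarrow> 'a set \<Rightarrow> bool" where
  "nowhere_dense j i X A \<longleftrightarrow> A \<in> sublocales (carr X) \<and> intr i X (cl j X A) = void"

definition first_category :: "nat \<Rightarrow> nat \<Rightarrow> 'a::frame triple \<Rightarrow> 'a set \<Rightarrow> bool" where
  "first_category j i X A \<longleftrightarrow>
     A \<in> sublocales (carr X) \<and>
     (\<exists>B::nat \<Rightarrow> 'a set. (\<forall>n. nowhere_dense j i X (B n)) \<and> A \<subseteq> sl_join (carr X) (range B))"

definition second_category :: "nat \<Rightarrow> nat \<Rightarrow> 'a::frame triple \<Rightarrow> 'a set \<Rightarrow> bool" where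
  "second_category j i X A \<longleftrightarrow> A \<in> sublocales (carr X) \<and> \<not> first_category j i X A"

definition relatively_Baire :: "nat \<Rightarrow> nat \<Rightarrow> 'a::frame triple \<Rightarrow> 'a triple \<Rightarrow> bool" where
  "relatively_Baire i j Y X \<longleftrightarrow>
     (\<forall>x::nat \<Rightarrow> 'a.
        (\<forall>n. x n \<in> part j X \<and> is_dense i X (open_sl (carr X) (x n))) \<longrightarrow>
        is_dense i Y (carr Y \<inter> (\<Inter>n. open_sl (carr X) (x n))))"

end

theory Submission
  imports Defs
begin

text \<open>
  For \<open>b\<^sub>n\<close> in \<open>L\<^sub>j\<close>, put \<open>G = \<Inter>\<^sub>n \<oo>(b\<^sub>n)\<close> and
  \<open>W = \<Or>\<^sub>n \<cc>(b\<^sub>n)\<close>.  If \<open>G\<close> is complemented, its complement is \<open>W\<close>.  A sublocale is of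
  first category iff it lies below such a \<open>W\<close> with all \<open>\<oo>(b\<^sub>n)\<close> being \<open>i\<close>-dense, so each
  category statement is the complementary form of the density of \<open>S \<inter> G\<close>.  Density of \<open>S\<close> makes
  the topological notions of \<open>S\<close> agree with those of \<open>L\<close>, and complementedness of \<open>S\<close> gives
  \<open>S \<inter> \<Or>\<^sub>n T\<^sub>n = \<Or>\<^sub>n (S \<inter> T\<^sub>n)\<close>, which transfers first category from \<open>L\<close> to \<open>S\<close>.
\<close>

abbreviation heyting :: "'a::frame \<Rightarrow> 'a \<Rightarrow> 'a" where
  "heyting \<equiv> imp_in UNIV"

section \<open>Heyting implication and nuclei\<close>

lemma inf_heyting_le: "inf x (heyting x y) \<le> y"
  by (metis inf_commute le_imp_in_UNIV order_refl)

lemma inf_heyting: "inf x (heyting x y) = inf x y"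
  by (meson inf_heyting_le inf.cobounded1 inf.cobounded2 inf_greatest le_imp_in_UNIV order_antisym
      order_trans)

text \<open>Yoneda principle for posets: with it, identities of the Heyting operation follow from
  the adjunction \<open>le_imp_in_UNIV\<close>.\<close>

lemma eq_if_same_lower_bounds:
  fixes x y :: "'a::order"
  shows "(\<And>z. z \<le> x \<longleftrightarrow> z \<le> y) \<Longrightarrow> x = y"
  by (auto intro: order_antisym)

lemma heyting_inf: "heyting x (inf y z) = inf (heyting x y) (heyting x z)"
  by (rule eq_if_same_lower_bounds) (simp add: le_imp_in_UNIV)

lemma heyting_heyting: "heyting x (heyting y z) = heyting (inf x y) z"
  by (rule eq_if_same_lower_bounds) (simp add: le_imp_in_UNIV inf_assoc)

lemma heyting_eq_top_iff: "heyting x y = top \<longleftrightarrow> x \<le> y"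
  by (metis inf_top_left le_imp_in_UNIV top_unique order_refl top_greatest)

lemma le_heyting: "y \<le> heyting x y"
  by (simp add: le_imp_in_UNIV)

lemma inf_sup_le:
  fixes x :: "'a::frame"
  assumes "inf x y \<le> w" "inf x z \<le> w"
  shows "inf x (sup y z) \<le> w"
proof -
  have "sup y z \<le> heyting x w"
    using assms by (intro sup_least) (simp_all add: le_imp_in_UNIV inf_commute)
  then show ?thesis
    by (simp only: le_imp_in_UNIV inf_commute)
qed

lemma sublocales_UNIV_iff:
  "T \<in> sublocales UNIV \<longleftrightarrow> (\<forall>B\<subseteq>T. Inf B \<in> T) \<and> (\<forall>x. \<forall>s\<in>T. heyting x s \<in> T)"
  by (simp add: sublocales_def)

lemma sublocale_Inf: "T \<in> sublocales C \<Longrightarrow> B \<subseteq> T \<Longrightarrow> Inf B \<in> T"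
  by (simp add: sublocales_def)

lemma sublocale_inf: "T \<in> sublocales C \<Longrightarrow> x \<in> T \<Longrightarrow> y \<in> T \<Longrightarrow> inf x y \<in> T"
  using sublocale_Inf[of T C "{x, y}"] by simp

lemma sublocale_top: "T \<in> sublocales C \<Longrightarrow> top \<in> T"
  using sublocale_Inf[of T C "{}"] by simp

lemma sublocale_heyting: "T \<in> sublocales UNIV \<Longrightarrow> s \<in> T \<Longrightarrow> heyting x s \<in> T"
  by (simp add: sublocales_def)

lemma void_sublocale: "S \<in> sublocales UNIV \<Longrightarrow> void \<in> sublocales S"
  using sublocale_top[of S UNIV]
  by (auto simp: sublocales_def void_def subset_singleton_iff imp_in_sublocale[of S]
      heyting_eq_top_iff sublocale_top)

lemma UNIV_sublocale: "UNIV \<in> sublocales UNIV"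
  by (simp add: sublocales_def)

lemma sublocale_Int:
  "A \<in> sublocales UNIV \<Longrightarrow> B \<in> sublocales UNIV \<Longrightarrow> A \<inter> B \<in> sublocales UNIV"
  by (simp add: sublocales_UNIV_iff)

lemma sublocale_Inter:
  "(\<And>A. A \<in> \<A> \<Longrightarrow> A \<in> sublocales UNIV) \<Longrightarrow> \<Inter>\<A> \<in> sublocales UNIV"
  by (simp add: sublocales_UNIV_iff le_Inf_iff)

lemma nucleus_mem: "S \<in> sublocales C \<Longrightarrow> nucleus S a \<in> S"
  unfolding nucleus_def by (rule sublocale_Inf) auto

lemma le_nucleus: "a \<le> nucleus S a"
  unfolding nucleus_def by (rule Inf_greatest) auto

lemma nucleus_le: "s \<in> S \<Longrightarrow> a \<le> s \<Longrightarrow> nucleus S a \<le> s"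
  unfolding nucleus_def by (rule Inf_lower) auto

lemma nucleus_le_iff: "s \<in> S \<Longrightarrow> nucleus S a \<le> s \<longleftrightarrow> a \<le> s"
  by (metis le_nucleus nucleus_le order_trans)

lemma nucleus_UNIV: "nucleus UNIV a = a"
  by (simp add: le_nucleus nucleus_le order_antisym)

text \<open>By adjunction \<open>z \<le> heyting x s\<close> amounts to
  \<open>x \<le> heyting z s\<close>; the right side lies in \<open>S\<close>, where
  \<open>x\<close> and \<open>nucleus S x\<close> have the same upper bounds.\<close>

lemma heyting_nucleus:
  assumes "S \<in> sublocales UNIV" "s \<in> S"
  shows "heyting (nucleus S x) s = heyting x s"
proof (rule eq_if_same_lower_bounds)
  show "z \<le> heyting (nucleus S x) s \<longleftrightarrow> z \<le> heyting x s" for z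
    using nucleus_le_iff[OF sublocale_heyting[OF assms], of x z]
    by (simp add: le_imp_in_UNIV inf_commute)
qed

text \<open>The antecedent \<open>x\<close> of an implication may lie outside \<open>S\<close>, but
  replacing it by \<open>nucleus S x\<close> does not change the value.\<close>

lemma sublocales_relative:
  assumes "S \<in> sublocales UNIV"
  shows "T \<in> sublocales S \<longleftrightarrow> T \<in> sublocales UNIV \<and> T \<subseteq> S"
proof
  assume T: "T \<in> sublocales S"
  have "heyting x t \<in> T" if "t \<in> T" for x t
  proof -
    have "imp_in S (nucleus S x) t \<in> T" "t \<in> S"
      using T that nucleus_mem[OF assms] by (auto simp: sublocales_def)
    then show ?thesis
      using assms by (simp add: imp_in_sublocale nucleus_mem heyting_nucleus)
  qed
  with T show "T \<in> sublocales UNIV \<and> T \<subseteq> S"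
    by (auto simp: sublocales_def)
next
  assume "T \<in> sublocales UNIV \<and> T \<subseteq> S"
  with assms show "T \<in> sublocales S"
    by (auto simp: sublocales_def imp_in_sublocale[OF assms] subset_iff)
qed

section \<open>Open and closed sublocales\<close>

text \<open>\<open>heyting a\<close> is idempotent, so its image is its set of fixed points.\<close>

lemma open_sl_iff: "x \<in> open_sl UNIV a \<longleftrightarrow> heyting a x = x"
  by (auto simp: open_sl_def heyting_heyting) (metis)

lemma open_sl_sublocale: "open_sl UNIV a \<in> sublocales UNIV"
proof -
  have "Inf B \<in> open_sl UNIV a" if "B \<subseteq> open_sl UNIV a" for B
  proof -
    have "heyting a (Inf B) \<le> b" if "b \<in> B" for b
    proof -
      have "inf (heyting a (Inf B)) a \<le> b"
        using that by (metis Inf_lower inf_commute inf_heyting_le order_trans)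
      then have "heyting a (Inf B) \<le> heyting a b" by (simp add: le_imp_in_UNIV)
      also have "\<dots> = b" using \<open>b \<in> B\<close> \<open>B \<subseteq> open_sl UNIV a\<close> by (auto simp: open_sl_iff)
      finally show ?thesis .
    qed
    then show ?thesis
      by (simp add: open_sl_iff Inf_greatest le_heyting order_antisym)
  qed
  moreover have "heyting x s \<in> open_sl UNIV a" if "s \<in> open_sl UNIV a" for x s
    using that by (metis heyting_heyting inf_commute open_sl_iff)
  ultimately show ?thesis by (simp add: sublocales_UNIV_iff)
qed

lemma open_sl_bot: "open_sl UNIV bot = void"
proof -
  have "heyting bot x = top" for x :: 'a by (simp add: heyting_eq_top_iff)
  then show ?thesis by (auto simp: open_sl_def void_def)
qed

lemma closed_sl_UNIV: "closed_sl UNIV a = {a..}"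
  by (auto simp: closed_sl_def)

lemma atLeast_sublocale: "{a..} \<in> sublocales UNIV"
  by (auto simp: sublocales_UNIV_iff intro: Inf_greatest order_trans[OF _ le_heyting])

text \<open>Open sublocales of \<open>S\<close> are traces of those of the frame, so the parameters
  can always be taken from the ambient parts.\<close>

lemma open_sl_relative:
  assumes "S \<in> sublocales UNIV"
  shows "open_sl S (nucleus S a) = S \<inter> open_sl UNIV a"
proof -
  have "imp_in S (nucleus S a) x = heyting a x" if "x \<in> S" for x
    using assms that by (simp add: imp_in_sublocale nucleus_mem heyting_nucleus)
  then have "open_sl S (nucleus S a) = {heyting a x | x. x \<in> S}"
    unfolding open_sl_def by (metis (no_types, lifting))
  also have "\<dots> = S \<inter> open_sl UNIV a"
    using sublocale_heyting[OF assms] by (force simp: open_sl_iff heyting_heyting)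
  finally show ?thesis .
qed

lemma closed_sl_relative: "closed_sl S (nucleus S a) = S \<inter> {a..}"
  by (auto simp: closed_sl_def nucleus_le_iff)

text \<open>For \<open>t \<in> T\<close> the element \<open>heyting a t\<close> lies both in
  \<open>T\<close> and in the open sublocale, hence is \<open>top\<close>.\<close>

lemma subset_atLeast_if_disjoint:
  assumes "T \<in> sublocales UNIV" "T \<inter> open_sl UNIV a \<subseteq> void"
  shows "T \<subseteq> {a..}"
proof
  fix t assume "t \<in> T"
  then have "heyting a t \<in> T \<inter> open_sl UNIV a"
    using assms(1) by (auto simp: open_sl_iff heyting_heyting sublocale_heyting)
  with assms(2) show "t \<in> {a..}" by (auto simp: void_def heyting_eq_top_iff)
qed

lemma open_sl_Int_atLeast: "open_sl UNIV a \<inter> {a..} = void"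
proof -
  have "heyting a x = x \<and> a \<le> x \<longleftrightarrow> x = top" for x
    using heyting_eq_top_iff[of a x] by auto
  then show ?thesis by (simp add: set_eq_iff open_sl_iff void_def)
qed

text \<open>The test element is \<open>heyting (heyting a t) t\<close>: it lies in \<open>T\<close>
  and above \<open>a\<close>, hence is \<open>top\<close>, which makes \<open>t\<close> a fixed
  point of \<open>heyting a\<close>.\<close>

lemma subset_open_sl_if_disjoint:
  assumes "T \<in> sublocales UNIV" "T \<inter> {a..} \<subseteq> void"
  shows "T \<subseteq> open_sl UNIV a"
proof
  fix t assume t: "t \<in> T"
  let ?d = "heyting a t"
  have "a \<le> heyting ?d t"
    by (simp add: le_imp_in_UNIV inf_heyting_le)
  then have "heyting ?d t \<in> T \<inter> {a..}" using assms(1) t by (simp add: sublocale_heyting)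
  with assms(2) have "?d \<le> t" by (auto simp: void_def heyting_eq_top_iff)
  then show "t \<in> open_sl UNIV a" by (simp add: open_sl_iff le_heyting order_antisym)
qed

section \<open>Joins and complements of sublocales\<close>

lemma sl_join_upper: "T \<in> \<T> \<Longrightarrow> T \<subseteq> sl_join C \<T>"
  by (auto simp: sl_join_def)

lemma sl_join_least: "U \<in> sublocales C \<Longrightarrow> (\<And>T. T \<in> \<T> \<Longrightarrow> T \<subseteq> U) \<Longrightarrow> sl_join C \<T> \<subseteq> U"
  by (auto simp: sl_join_def)

lemma sl_join_sublocale: "sl_join UNIV \<T> \<in> sublocales UNIV"
  unfolding sl_join_def by (rule sublocale_Inter) simp

lemma sl_join_relative:
  assumes "S \<in> sublocales UNIV" "\<And>T. T \<in> \<T> \<Longrightarrow> T \<subseteq> S"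
  shows "sl_join S \<T> = sl_join UNIV \<T>"
proof
  have "sl_join UNIV \<T> \<in> sublocales S"
    by (simp add: sublocales_relative assms sl_join_sublocale sl_join_least)
  then show "sl_join S \<T> \<subseteq> sl_join UNIV \<T>"
    by (rule sl_join_least) (rule sl_join_upper)
  show "sl_join UNIV \<T> \<subseteq> sl_join S \<T>"
    using sublocales_relative[OF assms(1)] unfolding sl_join_def by blast
qed

lemma sl_join_eq_void_iff:
  assumes "S \<in> sublocales UNIV" "\<And>T. T \<in> \<T> \<Longrightarrow> T \<subseteq> S"
  shows "sl_join S \<T> = void \<longleftrightarrow> (\<forall>T\<in>\<T>. T \<subseteq> void)"
proof
  assume "sl_join S \<T> = void"
  then show "\<forall>T\<in>\<T>. T \<subseteq> void" using sl_join_upper by blast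
next
  assume "\<forall>T\<in>\<T>. T \<subseteq> void"
  then have "sl_join S \<T> \<subseteq> void"
    using void_sublocale[OF assms(1)] sl_join_least by blast
  moreover have "top \<in> sl_join S \<T>"
    using sublocale_top[OF sl_join_sublocale] sl_join_relative[OF assms] by blast
  ultimately show "sl_join S \<T> = void" by (auto simp: void_def)
qed

lemma inf_mem_sl_join:
  assumes "a \<in> A" "b \<in> B"
  shows "inf a b \<in> sl_join UNIV {A, B}"
  using assms sl_join_upper[of _ "{A, B}"] by (intro sublocale_inf[OF sl_join_sublocale]) blast+

lemma sl_join_binary:
  assumes "A \<in> sublocales UNIV" "B \<in> sublocales UNIV"
  shows "sl_join UNIV {A, B} = {inf a b | a b. a \<in> A \<and> b \<in> B}" (is "_ = ?J")
proof
  have "Inf M \<in> ?J" if "M \<subseteq> ?J" for M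
  proof -
    \<comment> \<open>Canonical choice: no decomposition is selected for each \<open>m\<close>; all
      elements of \<open>A\<close> (of \<open>B\<close>) above some member of \<open>M\<close> are
      met at once.\<close>
    let ?a = "Inf {a \<in> A. \<exists>m\<in>M. m \<le> a}" and ?b = "Inf {b \<in> B. \<exists>m\<in>M. m \<le> b}"
    have "inf ?a ?b \<le> m" if m: "m \<in> M" for m
    proof -
      obtain a b where ab: "m = inf a b" "a \<in> A" "b \<in> B" using subsetD[OF \<open>M \<subseteq> ?J\<close> m] by blast
      then have "?a \<le> a" "?b \<le> b" using m by (auto intro!: Inf_lower bexI[of _ m])
      then show ?thesis using ab(1) by (simp add: le_infI1 le_infI2)
    qed
    moreover have "Inf M \<le> ?a" "Inf M \<le> ?b"
      by (auto intro!: Inf_greatest intro: Inf_lower2)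
    ultimately have "Inf M = inf ?a ?b" by (intro order_antisym Inf_greatest) auto
    moreover have "?a \<in> A" "?b \<in> B" using assms by (auto intro!: sublocale_Inf)
    ultimately show ?thesis by blast
  qed
  moreover have "heyting x m \<in> ?J" if m: "m \<in> ?J" for x m
  proof -
    obtain a b where "m = inf a b" "a \<in> A" "b \<in> B" using m by blast
    then have "heyting x m = inf (heyting x a) (heyting x b)" "heyting x a \<in> A" "heyting x b \<in> B"
      using assms by (simp_all add: heyting_inf sublocale_heyting)
    then show ?thesis by blast
  qed
  ultimately have J: "?J \<in> sublocales UNIV" by (simp add: sublocales_UNIV_iff)
  have "a = inf a top" "a = inf top a" for a :: 'a by simp_all
  then have "A \<subseteq> ?J" "B \<subseteq> ?J"
    using sublocale_top[OF assms(1)] sublocale_top[OF assms(2)] by blast+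
  then show "sl_join UNIV {A, B} \<subseteq> ?J" by (intro sl_join_least[OF J]) auto
  show "?J \<subseteq> sl_join UNIV {A, B}"
    by (auto intro: inf_mem_sl_join)
qed

text \<open>
  The second component can be taken to be \<open>a \<rightarrow> z\<close>, which lies in every sublocale containing \<open>z\<close>;
  this yields the distributivity of sublocales.
\<close>

lemma sl_join_binary_cases:
  assumes "A \<in> sublocales UNIV" "B \<in> sublocales UNIV" "z \<in> sl_join UNIV {A, B}"
  obtains a where "a \<in> A" "heyting a z \<in> B" "z = inf a (heyting a z)"
proof -
  obtain a b where ab: "a \<in> A" "b \<in> B" "z = inf a b"
    using assms by (auto simp: sl_join_binary)
  then have "heyting a z = heyting a b"
    by (metis heyting_eq_top_iff heyting_inf inf_top_left order_refl)
  then have "heyting a z \<in> B" using ab(2) assms(2) by (simp add: sublocale_heyting)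
  moreover have "z = inf a (heyting a z)"
    using ab(3) by (simp add: inf_heyting)
  ultimately show ?thesis using that ab(1) by blast
qed

text \<open>In the decomposition \<open>t = inf a (heyting a t)\<close> the second factor lies in
  \<open>T \<inter> B\<close>, hence is \<open>top\<close>, so \<open>t = a\<close>.\<close>

lemma subset_if_disjoint:
  assumes "A \<in> sublocales UNIV" "B \<in> sublocales UNIV" "T \<in> sublocales UNIV"
    and "T \<subseteq> sl_join UNIV {A, B}" "T \<inter> B \<subseteq> void"
  shows "T \<subseteq> A"
proof
  fix t assume t: "t \<in> T"
  with assms obtain a where a: "a \<in> A" "heyting a t \<in> B" "t = inf a (heyting a t)"
    by (meson sl_join_binary_cases subsetD)
  have "heyting a t = top"
    using a(2) sublocale_heyting[OF assms(3) t] assms(5) by (auto simp: void_def)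
  with a show "t \<in> A" by simp
qed

text \<open>In a coframe, meets need not distribute over infinite joins. With a complement
  \<open>D\<close> of \<open>S\<close>, each \<open>t \<in> T\<close> splits as
  \<open>inf d (heyting d t)\<close> with second factor in \<open>S \<inter> T\<close>; so the join
  lies below \<open>?J\<close> joined with \<open>D\<close>, and meeting with \<open>S\<close>
  removes \<open>D\<close>.\<close>

lemma complemented_Int_sl_join:
  assumes "complemented UNIV S" "\<And>T. T \<in> \<T> \<Longrightarrow> T \<in> sublocales UNIV"
  shows "S \<inter> sl_join UNIV \<T> \<subseteq> sl_join UNIV ((\<inter>) S ` \<T>)" (is "_ \<subseteq> ?J")
proof -
  obtain D where S: "S \<in> sublocales UNIV" and D: "D \<in> sublocales UNIV"
    and SD: "S \<inter> D = void" "sl_join UNIV {D, S} = UNIV"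
    using assms(1) by (auto simp: complemented_def insert_commute)
  have J: "?J \<in> sublocales UNIV" by (rule sl_join_sublocale)
  have "T \<subseteq> sl_join UNIV {?J, D}" if T: "T \<in> \<T>" for T
  proof
    fix t assume "t \<in> T"
    obtain d where d: "d \<in> D" "heyting d t \<in> S" "t = inf d (heyting d t)"
      using sl_join_binary_cases[OF D S, of t] SD by auto
    have "heyting d t \<in> S \<inter> T" using d assms(2)[OF T] \<open>t \<in> T\<close> by (simp add: sublocale_heyting)
    then have "heyting d t \<in> ?J"
      using sl_join_upper[of "S \<inter> T" "(\<inter>) S ` \<T>" UNIV] T by blast
    then show "t \<in> sl_join UNIV {?J, D}"
      using d(1,3) inf_mem_sl_join[of "heyting d t" ?J d D] by (simp add: inf_commute)
  qed
  then have "sl_join UNIV \<T> \<subseteq> sl_join UNIV {?J, D}"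
    by (intro sl_join_least sl_join_sublocale)
  then show ?thesis
    using SD by (intro subset_if_disjoint[OF J D sublocale_Int[OF S sl_join_sublocale]]) auto
qed

text \<open>The complement \<open>D\<close> of the intersection contains every
  \<open>{b n..}\<close>, hence their join; the work is in the reverse inclusion.\<close>

lemma complement_INT_open_sl:
  fixes b :: "nat \<Rightarrow> 'a::frame"
  assumes "complemented UNIV (\<Inter>n. open_sl UNIV (b n))"
  shows "(\<Inter>n. open_sl UNIV (b n)) \<inter> sl_join UNIV (range (\<lambda>n. {b n..})) \<subseteq> void"
    and "T \<in> sublocales UNIV \<Longrightarrow> T \<inter> (\<Inter>n. open_sl UNIV (b n)) \<subseteq> void \<Longrightarrow>
      T \<subseteq> sl_join UNIV (range (\<lambda>n. {b n..}))"
proof -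
  let ?G = "\<Inter>n. open_sl UNIV (b n)" and ?W = "sl_join UNIV (range (\<lambda>n. {b n..}))"
  obtain D where G: "?G \<in> sublocales UNIV" and D: "D \<in> sublocales UNIV"
    and GD: "?G \<inter> D = void" "sl_join UNIV {D, ?G} = UNIV"
    using assms by (auto simp: complemented_def insert_commute)
  have "{b n..} \<subseteq> D" for n
    using GD open_sl_Int_atLeast[of "b n"]
    by (intro subset_if_disjoint[OF D G atLeast_sublocale]) auto
  then have "?W \<subseteq> D" by (intro sl_join_least[OF D]) auto
  then show "?G \<inter> ?W \<subseteq> void" using GD by blast
  have W: "?W \<in> sublocales UNIV" by (rule sl_join_sublocale)
  have "D \<subseteq> ?W"
  proof
    fix x assume x: "x \<in> D"
    \<comment> \<open>\<open>?w\<close> is the least element of \<open>?W\<close> above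
      \<open>x\<close>. The aim is \<open>?w \<le> x\<close>, that is \<open>?y = top\<close>,
      reached by placing \<open>?y\<close> in both \<open>?G\<close> and \<open>D\<close>.\<close>
    let ?w = "nucleus ?W x" and ?y = "heyting (nucleus ?W x) x"
    have "?y \<in> open_sl UNIV (b n)" for n
    proof -
      have "sup (b n) x \<in> ?W"
        using sl_join_upper[of "{b n..}" "range (\<lambda>n. {b n..})" UNIV] by auto
      then have "?w \<le> sup (b n) x" by (simp add: nucleus_le)
      \<comment> \<open>\<open>?h\<close> meets both \<open>b n\<close> and \<open>x\<close> below
        \<open>x\<close>. As \<open>?h \<le> ?w \<le> sup (b n) x\<close>, distributivity gives
        \<open>?h \<le> x\<close>, which is the fixed-point inequality for
        \<open>?y\<close>.\<close>
      let ?h = "inf (heyting (b n) ?y) ?w"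
      have "inf ?h (b n) \<le> x"
        by (simp add: heyting_heyting inf_assoc inf_commute[of ?w] inf_heyting_le flip: le_imp_in_UNIV)
      then have "inf ?h (sup (b n) x) \<le> x" by (rule inf_sup_le) simp
      moreover have "inf ?h (sup (b n) x) = ?h"
        using \<open>?w \<le> sup (b n) x\<close> by (simp add: le_infI2 inf_absorb1)
      ultimately have "heyting (b n) ?y \<le> ?y"
        by (simp only: le_imp_in_UNIV)
      then show ?thesis by (simp add: open_sl_iff le_heyting order_antisym)
    qed
    then have "?y \<in> ?G \<inter> D" using sublocale_heyting[OF D x] by blast
    then have "?w \<le> x" using GD by (simp add: void_def heyting_eq_top_iff)
    then show "x \<in> ?W" using nucleus_mem[OF W] le_nucleus by (metis order_antisym)
  qed
  moreover assume "T \<in> sublocales UNIV" "T \<inter> ?G \<subseteq> void"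
  then have "T \<subseteq> D" using GD by (intro subset_if_disjoint[OF D G]) auto
  ultimately show "T \<subseteq> ?W" by blast
qed

section \<open>Density and category in a dense subbilocale\<close>

text \<open>
  The ambient bilocale is the instance \<open>S = UNIV\<close>, so that the characterizations below apply to
  it and to its dense subbilocales alike, always in terms of the parts \<open>F k\<close> of the ambient one.
\<close>

locale dense_subbilocale =
  fixes Y :: "'a::frame triple" and S :: "'a set" and F :: "nat \<Rightarrow> 'a set"
  assumes carr: "carr Y = S"
    and S_sublocale: "S \<in> sublocales UNIV"
    and bot_mem: "bot \<in> S"
    and part: "part k Y = nucleus S ` F k"
    and Sup_mem: "B \<subseteq> F k \<Longrightarrow> Sup B \<in> F k"
begin

lemma open_part_Int_subset_void_iff: "S \<inter> open_sl UNIV a \<subseteq> void \<longleftrightarrow> a = bot"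
proof
  assume "S \<inter> open_sl UNIV a \<subseteq> void"
  then have "bot \<in> {a..}"
    using subset_atLeast_if_disjoint[OF S_sublocale] bot_mem by blast
  then show "a = bot" by (simp add: bot_unique)
qed (simp add: open_sl_bot)

text \<open>The pseudocomplement \<open>heyting a bot\<close> is the test element; it lies in
  \<open>S\<close> because \<open>bot\<close> does. The right side does not mention
  \<open>S\<close>, which is how density transfers between the frame and \<open>S\<close>.\<close>

lemma open_part_subset_atLeast_iff: "S \<inter> open_sl UNIV a \<subseteq> {b..} \<longleftrightarrow> inf a b = bot"
proof
  assume "S \<inter> open_sl UNIV a \<subseteq> {b..}"
  moreover have "heyting a bot \<in> S \<inter> open_sl UNIV a"
    using bot_mem S_sublocale by (simp add: sublocale_heyting open_sl_iff heyting_heyting)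
  ultimately have "b \<le> heyting a bot" by auto
  then show "inf a b = bot" by (simp add: le_imp_in_UNIV inf_commute bot_unique)
next
  assume ab: "inf a b = bot"
  show "S \<inter> open_sl UNIV a \<subseteq> {b..}"
  proof
    fix x assume "x \<in> S \<inter> open_sl UNIV a"
    then have "heyting a x = x" by (simp add: open_sl_iff)
    moreover have "b \<le> heyting a x" using ab by (simp add: le_imp_in_UNIV inf_commute)
    ultimately show "x \<in> {b..}" by simp
  qed
qed

lemma cl_eq:
  assumes "A \<subseteq> S"
  shows "cl k Y A = S \<inter> {Sup {a \<in> F k. A \<subseteq> {a..}}..}"
proof -
  have "{closed_sl S a | a. a \<in> nucleus S ` F k \<and> A \<subseteq> closed_sl S a}
      = (\<lambda>a. closed_sl S (nucleus S a)) ` {a \<in> F k. A \<subseteq> closed_sl S (nucleus S a)}"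
    by blast
  then have "cl k Y A = (\<Inter>a\<in>{a \<in> F k. A \<subseteq> {a..}}. S \<inter> {a..})"
    using assms by (simp add: cl_def carr part closed_sl_relative)
  also have "\<dots> = S \<inter> {Sup {a \<in> F k. A \<subseteq> {a..}}..}"
  proof -
    \<comment> \<open>This keeps the index set nonempty; an empty intersection would be
      \<open>UNIV\<close> instead of \<open>S\<close>.\<close>
    have "bot \<in> F k" using Sup_mem[of "{}"] by simp
    then show ?thesis by (auto simp: Sup_le_iff)
  qed
  finally show ?thesis .
qed

lemma is_dense_iff:
  assumes "A \<subseteq> S"
  shows "is_dense k Y A \<longleftrightarrow> (\<forall>a\<in>F k. A \<subseteq> {a..} \<longrightarrow> a = bot)"
proof -
  have "is_dense k Y A \<longleftrightarrow> S \<subseteq> {Sup {a \<in> F k. A \<subseteq> {a..}}..}"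
    using assms by (auto simp: is_dense_def carr cl_eq)
  also have "S \<subseteq> {c..} \<longleftrightarrow> c = bot" for c
    using bot_mem by (auto simp: bot_unique)
  finally show ?thesis by (auto simp: Sup_bot_conv)
qed

lemma intr_eq_void_iff:
  "intr k Y A = void \<longleftrightarrow> (\<forall>a\<in>F k. S \<inter> open_sl UNIV a \<subseteq> A \<longrightarrow> a = bot)"
proof -
  have "{open_sl S a | a. a \<in> nucleus S ` F k \<and> open_sl S a \<subseteq> A}
      = (\<lambda>a. open_sl S (nucleus S a)) ` {a \<in> F k. open_sl S (nucleus S a) \<subseteq> A}"
    by blast
  then have intr: "intr k Y A
      = sl_join S ((\<lambda>a. S \<inter> open_sl UNIV a) ` {a \<in> F k. S \<inter> open_sl UNIV a \<subseteq> A})"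
    by (simp add: intr_def carr part open_sl_relative[OF S_sublocale])
  have "sl_join S ((\<lambda>a. S \<inter> open_sl UNIV a) ` I) = void \<longleftrightarrow> (\<forall>a\<in>I. S \<inter> open_sl UNIV a \<subseteq> void)"
    for I
    by (subst sl_join_eq_void_iff[OF S_sublocale]) auto
  then show ?thesis
    by (auto simp: intr open_part_Int_subset_void_iff)
qed

text \<open>Equivalent to \<open>\<oo>(b)\<close> being \<open>i\<close>-dense, in the ambient bilocale as well as in \<open>S\<close>.\<close>

definition dense_elt :: "nat \<Rightarrow> 'a \<Rightarrow> bool" where
  "dense_elt i b \<longleftrightarrow> (\<forall>a\<in>F i. inf a b = bot \<longrightarrow> a = bot)"

text \<open>By \<open>cl_eq\<close> the \<open>j\<close>-closure of \<open>A\<close> is the trace on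
  \<open>S\<close> of \<open>{?b..}\<close>, so nowhere density says that \<open>?b\<close> is
  dense. Any other witness lies below \<open>?b\<close>, and density of elements passes
  upwards.\<close>

lemma nowhere_dense_iff:
  "nowhere_dense j i Y A \<longleftrightarrow>
     A \<in> sublocales UNIV \<and> A \<subseteq> S \<and> (\<exists>b\<in>F j. dense_elt i b \<and> A \<subseteq> {b..})"
proof (cases "A \<in> sublocales UNIV \<and> A \<subseteq> S")
  case True
  let ?b = "Sup {a \<in> F j. A \<subseteq> {a..}}"
  have "nowhere_dense j i Y A \<longleftrightarrow> (\<forall>a\<in>F i. S \<inter> open_sl UNIV a \<subseteq> {?b..} \<longrightarrow> a = bot)"
    using True
    by (auto simp: nowhere_dense_def carr sublocales_relative[OF S_sublocale] intr_eq_void_iff cl_eq)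
  also have "\<dots> \<longleftrightarrow> dense_elt i ?b"
    by (simp add: dense_elt_def open_part_subset_atLeast_iff)
  also have "\<dots> \<longleftrightarrow> (\<exists>b\<in>F j. dense_elt i b \<and> A \<subseteq> {b..})"
  proof
    assume "dense_elt i ?b"
    moreover have "?b \<in> F j" by (rule Sup_mem) auto
    moreover have "A \<subseteq> {?b..}" by (auto intro!: Sup_least)
    ultimately show "\<exists>b\<in>F j. dense_elt i b \<and> A \<subseteq> {b..}" by blast
  next
    assume "\<exists>b\<in>F j. dense_elt i b \<and> A \<subseteq> {b..}"
    then obtain b where b: "b \<in> F j" "dense_elt i b" "A \<subseteq> {b..}" by blast
    then have "b \<le> ?b" by (simp add: Sup_upper)
    then have "inf a b \<le> inf a ?b" for a by (rule inf_mono[OF order_refl])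
    then have "inf a b = bot" if "inf a ?b = bot" for a
      using that bot_unique[of "inf a b"] by metis
    with b(2) show "dense_elt i ?b" by (simp add: dense_elt_def)
  qed
  finally show ?thesis using True by simp
next
  case False
  then show ?thesis by (auto simp: nowhere_dense_def carr sublocales_relative[OF S_sublocale])
qed

text \<open>Each nowhere dense sublocale can be enlarged to some \<open>S \<inter> {b..}\<close>
  with \<open>b\<close> dense, which is again nowhere dense, so sequences of dense elements
  suffice.\<close>

lemma first_category_iff:
  "first_category j i Y A \<longleftrightarrow> A \<in> sublocales UNIV \<and> A \<subseteq> S \<and>
     (\<exists>b::nat \<Rightarrow> 'a. (\<forall>n. b n \<in> F j \<and> dense_elt i (b n)) \<and>
        A \<subseteq> sl_join UNIV (range (\<lambda>n. S \<inter> {b n..})))"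
proof
  assume A: "first_category j i Y A"
  then obtain B :: "nat \<Rightarrow> 'a set" where B: "\<And>n. nowhere_dense j i Y (B n)" "A \<subseteq> sl_join S (range B)"
    by (auto simp: first_category_def carr)
  then have "\<forall>n. \<exists>b. b \<in> F j \<and> dense_elt i b \<and> B n \<subseteq> {b..}" and BS: "\<And>n. B n \<subseteq> S"
    using B(1)[unfolded nowhere_dense_iff] by blast+
  then obtain b where b: "\<And>n. b n \<in> F j" "\<And>n. dense_elt i (b n)" "\<And>n. B n \<subseteq> {b n..}"
    by metis
  have "sl_join S (range B) \<subseteq> sl_join UNIV (range (\<lambda>n. S \<inter> {b n..}))"
  proof (subst sl_join_relative[OF S_sublocale])
    show "T \<subseteq> S" if "T \<in> range B" for T using that BS by blast
    have "B n \<subseteq> sl_join UNIV (range (\<lambda>n. S \<inter> {b n..}))" for n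
      using BS[of n] b(3)[of n] sl_join_upper[of "S \<inter> {b n..}" "range (\<lambda>n. S \<inter> {b n..})" UNIV]
      by blast
    then show "sl_join UNIV (range B) \<subseteq> sl_join UNIV (range (\<lambda>n. S \<inter> {b n..}))"
      by (intro sl_join_least sl_join_sublocale) blast
  qed
  with A B(2) b show "A \<in> sublocales UNIV \<and> A \<subseteq> S \<and> (\<exists>b::nat \<Rightarrow> 'a.
      (\<forall>n. b n \<in> F j \<and> dense_elt i (b n)) \<and> A \<subseteq> sl_join UNIV (range (\<lambda>n. S \<inter> {b n..})))"
    by (auto simp: first_category_def carr sublocales_relative[OF S_sublocale] intro!: exI[of _ b])
next
  assume "A \<in> sublocales UNIV \<and> A \<subseteq> S \<and> (\<exists>b::nat \<Rightarrow> 'a.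
      (\<forall>n. b n \<in> F j \<and> dense_elt i (b n)) \<and> A \<subseteq> sl_join UNIV (range (\<lambda>n. S \<inter> {b n..})))"
  then obtain b :: "nat \<Rightarrow> 'a" where A: "A \<in> sublocales S"
    and b: "\<And>n. b n \<in> F j" "\<And>n. dense_elt i (b n)"
    and sub: "A \<subseteq> sl_join UNIV (range (\<lambda>n. S \<inter> {b n..}))"
    by (auto simp: sublocales_relative[OF S_sublocale])
  have "nowhere_dense j i Y (S \<inter> {b n..})" for n
    using b sublocale_Int[OF S_sublocale atLeast_sublocale] by (auto simp: nowhere_dense_iff)
  moreover have "A \<subseteq> sl_join S (range (\<lambda>n. S \<inter> {b n..}))"
    using sub by (subst sl_join_relative[OF S_sublocale]) auto
  ultimately show "first_category j i Y A"
    unfolding first_category_def carr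
    using A by (intro conjI exI[of _ "\<lambda>n. S \<inter> {b n..}"]) auto
qed

end

section \<open>The four conditions, proved equivalent by one cycle of implications\<close>

theorem proposition3p10:
  fixes L1 L2 S S1 S2 :: "'a::frame set" and i j :: nat
  defines "X \<equiv> (UNIV, L1, L2)" and "Y \<equiv> (S, S1, S2)"
  assumes "{i, j} = {1, 2}"
    and "bilocale X"
    and "subbilocale Y X"
    and "dense_sl UNIV S"
    and "complemented UNIV S"
    and "\<And>G. is_Gdelta j X G \<Longrightarrow> complemented UNIV G"
  defines "baire \<equiv> relatively_Baire i j Y X"
    and "second \<equiv> (\<forall>U. is_open i X U \<and> U \<noteq> void \<longrightarrow> second_category j i Y (S \<inter> U))"
    and "first_int \<equiv> (\<forall>U. first_category j i X U \<longrightarrow> intr i Y (S \<inter> U) = void)"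
    and "first_dense \<equiv> (\<forall>V. first_category j i X V \<longrightarrow> is_dense i Y (S \<inter> sl_diff UNIV V))"
  shows "(baire \<longleftrightarrow> second) \<and> (baire \<longleftrightarrow> first_int) \<and> (baire \<longleftrightarrow> first_dense)"
proof -
  define F where "F k = part k X" for k
  have carrX: "carr X = UNIV" and carrY: "carr Y = S"
    by (simp_all add: X_def Y_def carr_def)
  have S: "S \<in> sublocales UNIV"
    using \<open>complemented UNIV S\<close> by (simp add: complemented_def)
  have F_Sup: "Sup B \<in> F k" if "B \<subseteq> F k" for B k
    using that \<open>bilocale X\<close> carrX
    by (auto simp: F_def part_def bilocale_def subframe_def join_in_UNIV split: if_splits)
  \<comment> \<open>The closure of \<open>S\<close> is the closed sublocale of \<open>Inf S\<close>,
    so density forces it to contain \<open>bot\<close>.\<close>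
  have "Inf S = bot"
  proof -
    have "S \<subseteq> closed_sl UNIV (Inf S)" by (auto simp: closed_sl_UNIV Inf_lower)
    then have "bot \<in> closed_sl UNIV (Inf S)"
      using \<open>dense_sl UNIV S\<close> unfolding dense_sl_def by blast
    then show ?thesis by (simp add: closed_sl_UNIV bot_unique)
  qed
  then have bot_S: "bot \<in> S" using sublocale_Inf[OF S order_refl] by simp
  interpret X: dense_subbilocale X UNIV F
    by unfold_locales (use F_Sup in \<open>auto simp: carrX UNIV_sublocale F_def nucleus_UNIV\<close>)
  interpret Y: dense_subbilocale Y S F
    by unfold_locales
      (use F_Sup bot_S S \<open>subbilocale Y X\<close> in \<open>auto simp: carrY F_def part_def subbilocale_def\<close>)
  \<comment> \<open>\<open>dense_elt\<close> depends on \<open>F\<close> alone, so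
    \<open>X.dense_elt\<close> and \<open>Y.dense_elt\<close> coincide and \<open>Seqs\<close>
    serves both bilocales.\<close>
  define Seqs :: "(nat \<Rightarrow> 'a) set" where "Seqs = {b. \<forall>n. b n \<in> F j \<and> X.dense_elt i (b n)}"
  define G where "G b = (\<Inter>n. open_sl UNIV (b n))" for b :: "nat \<Rightarrow> 'a"
  define W where "W b = sl_join UNIV (range (\<lambda>n. {b n..}))" for b :: "nat \<Rightarrow> 'a"
  have W: "W b \<in> sublocales UNIV" for b by (simp add: W_def sl_join_sublocale)
  have G: "G b \<in> sublocales UNIV" for b by (auto simp: G_def open_sl_sublocale intro: sublocale_Inter)
  have Gc: "complemented UNIV (G b)" if "b \<in> Seqs" for b
    using that \<open>\<And>G. is_Gdelta j X G \<Longrightarrow> complemented UNIV G\<close>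
    by (auto simp: is_Gdelta_def carrX Seqs_def G_def F_def)
  have GW: "G b \<inter> W b \<subseteq> void" if "b \<in> Seqs" for b
    using complement_INT_open_sl(1) Gc[OF that] by (simp add: G_def W_def)
  have disj_G: "T \<subseteq> W b" if "b \<in> Seqs" "T \<in> sublocales UNIV" "T \<inter> G b \<subseteq> void" for b T
    using complement_INT_open_sl(2) Gc[OF that(1)] that(2,3) by (simp add: G_def W_def)
  have catX: "first_category j i X A \<longleftrightarrow> A \<in> sublocales UNIV \<and> (\<exists>b\<in>Seqs. A \<subseteq> W b)" for A
    by (simp add: X.first_category_iff Seqs_def W_def Bex_def)
  \<comment> \<open>The inclusion from left to right rests on complementedness of
    \<open>S\<close>.\<close>
  have SW: "S \<inter> W b = sl_join UNIV (range (\<lambda>n. S \<inter> {b n..}))" (is "_ = ?J") for b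
  proof
    have "T \<in> sublocales UNIV" if "T \<in> range (\<lambda>n. {b n..})" for T
      using that atLeast_sublocale by blast
    from complemented_Int_sl_join[OF \<open>complemented UNIV S\<close>, of "range (\<lambda>n. {b n..})", OF this]
    show "S \<inter> W b \<subseteq> ?J" by (simp add: W_def image_image)
    have "{b n..} \<subseteq> W b" for n
      unfolding W_def by (rule sl_join_upper) simp
    then show "?J \<subseteq> S \<inter> W b"
      by (intro sl_join_least sublocale_Int S W) blast
  qed
  \<comment> \<open>By \<open>SW\<close>, a sublocale inside \<open>S\<close> has first category in
    \<open>S\<close> exactly when it has first category in the frame.\<close>
  have catY: "first_category j i Y A \<longleftrightarrow> A \<in> sublocales UNIV \<and> A \<subseteq> S \<and> (\<exists>b\<in>Seqs. A \<subseteq> W b)"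
    for A
  proof -
    have "first_category j i Y A \<longleftrightarrow> A \<in> sublocales UNIV \<and> A \<subseteq> S \<and> (\<exists>b\<in>Seqs. A \<subseteq> S \<inter> W b)"
      unfolding Y.first_category_iff SW Bex_def Seqs_def mem_Collect_eq ..
    then show ?thesis by (simp cong: conj_cong)
  qed
  have "is_dense i X (open_sl UNIV b) \<longleftrightarrow> X.dense_elt i b" for b
    using X.open_part_subset_atLeast_iff[of b]
    by (simp add: X.is_dense_iff X.dense_elt_def inf_commute)
  then have "baire \<longleftrightarrow> (\<forall>b\<in>Seqs. is_dense i Y (S \<inter> G b))"
    by (auto simp: baire_def relatively_Baire_def carrX carrY Seqs_def G_def F_def)
  then have baire: "baire \<longleftrightarrow> (\<forall>b\<in>Seqs. \<forall>a\<in>F i. S \<inter> G b \<subseteq> {a..} \<longrightarrow> a = bot)"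
    by (simp add: Y.is_dense_iff)

  \<comment> \<open>If \<open>S \<inter> U\<close> lay in \<open>W b\<close>, then
    \<open>S \<inter> G b\<close> would miss \<open>U\<close>, hence lie in \<open>{a..}\<close>,
    and the Baire condition would make \<open>U\<close> void.\<close>
  have second if baire
    unfolding second_def
  proof (intro allI impI)
    fix U assume "is_open i X U \<and> U \<noteq> void"
    then obtain a where a: "a \<in> F i" "U = open_sl UNIV a" "U \<noteq> void"
      by (auto simp: is_open_def carrX F_def)
    have U: "S \<inter> U \<in> sublocales UNIV" by (simp add: a S sublocale_Int open_sl_sublocale)
    have False if "first_category j i Y (S \<inter> U)"
    proof -
      obtain b where b: "b \<in> Seqs" "S \<inter> U \<subseteq> W b" using \<open>first_category j i Y (S \<inter> U)\<close> catY by blast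
      then have "S \<inter> G b \<inter> open_sl UNIV a \<subseteq> void" using GW a(2) by blast
      then have "S \<inter> G b \<subseteq> {a..}"
        by (intro subset_atLeast_if_disjoint sublocale_Int S G)
      with \<open>baire\<close> b(1) a(1) have "a = bot" using baire by blast
      with a show False by (simp add: open_sl_bot)
    qed
    with U show "second_category j i Y (S \<inter> U)"
      by (auto simp: second_category_def carrY sublocales_relative[OF S])
  qed
  \<comment> \<open>An \<open>i\<close>-open part of \<open>S\<close> inside \<open>V\<close>
    inherits first category and so must come from the void open sublocale.\<close>
  moreover have first_int if second
    unfolding first_int_def Y.intr_eq_void_iff
  proof (intro allI impI ballI)
    fix V a assume "first_category j i X V" and a: "a \<in> F i" "S \<inter> open_sl UNIV a \<subseteq> S \<inter> V"
    then have "first_category j i Y (S \<inter> open_sl UNIV a)"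
      using S by (auto simp: catX catY sublocale_Int open_sl_sublocale)
    then have "open_sl UNIV a = void"
      using \<open>second\<close> a(1) by (auto simp: second_def second_category_def is_open_def carrX F_def)
    then show "a = bot" using Y.open_part_Int_subset_void_iff by blast
  qed
  \<comment> \<open>Since \<open>V\<close> misses \<open>G b\<close>, its difference contains
    \<open>G b\<close>. An \<open>i\<close>-open part of \<open>S\<close> missing the difference
    thus misses \<open>G b\<close> and falls into \<open>W b\<close>; the interior condition is
    applied to \<open>W b\<close>, not to \<open>V\<close>.\<close>
  moreover have first_dense if first_int
    unfolding first_dense_def
  proof (intro allI impI)
    fix V assume V: "first_category j i X V"
    then obtain b where b: "b \<in> Seqs" "V \<subseteq> W b" "V \<in> sublocales UNIV" using catX by blast
    have "top \<in> G b" "top \<in> V" using sublocale_top G b(3) by auto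
    then have "G b \<inter> V = void" using GW[OF b(1)] b(2) by (auto simp: void_def)
    then have GV: "G b \<subseteq> sl_diff UNIV V"
      unfolding sl_diff_def using G by (intro sl_join_upper) simp
    have "a = bot" if a: "a \<in> F i" "S \<inter> sl_diff UNIV V \<subseteq> {a..}" for a
    proof -
      have "S \<inter> open_sl UNIV a \<inter> G b \<subseteq> void"
        using a(2) GV open_sl_Int_atLeast[of a] by blast
      then have "S \<inter> open_sl UNIV a \<subseteq> W b"
        by (intro disj_G b(1) sublocale_Int S open_sl_sublocale)
      moreover have "first_category j i X (W b)" using b(1) W catX by blast
      ultimately show ?thesis
        using \<open>first_int\<close> a(1) by (auto simp: first_int_def Y.intr_eq_void_iff)
    qed
    then show "is_dense i Y (S \<inter> sl_diff UNIV V)" by (simp add: Y.is_dense_iff)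
  qed
  \<comment> \<open>Take \<open>V = W b\<close>: whatever misses \<open>W b\<close> misses every
    \<open>{b n..}\<close>, so the difference lies in \<open>G b\<close>, and density passes to the
    larger sublocale.\<close>
  moreover have baire if first_dense
    unfolding baire
  proof (intro ballI impI)
    fix b a assume b: "b \<in> Seqs" and a: "a \<in> F i" "S \<inter> G b \<subseteq> {a..}"
    have "first_category j i X (W b)" using b W catX by blast
    then have dense: "is_dense i Y (S \<inter> sl_diff UNIV (W b))"
      using \<open>first_dense\<close> by (simp add: first_dense_def)
    have "T \<subseteq> G b" if T: "T \<in> sublocales UNIV" "T \<inter> W b = void" for T
    proof -
      have "{b n..} \<subseteq> W b" for n unfolding W_def by (rule sl_join_upper) simp
      then have "T \<inter> {b n..} \<subseteq> void" for n using T(2) by blast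
      then show ?thesis unfolding G_def using subset_open_sl_if_disjoint[OF T(1)] by blast
    qed
    then have "sl_diff UNIV (W b) \<subseteq> G b"
      unfolding sl_diff_def by (intro sl_join_least G) auto
    with a dense show "a = bot" by (auto simp: Y.is_dense_iff)
  qed
  ultimately show ?thesis by blast
qed

end
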